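(* Let $1\le m\le N$, let $K\subset\mathbb{R}^N$ be a bounded $m$-rectifiable set, and let $V=g\,\mathcal{H}^m|_K\otimes\delta_{TK}$ be a rectifiable $m$-varifold in $\mathbb{R}^N$ belonging to the class $H(2)$, with generalized mean curvature $\mathbf{H}$ and finite nonzero mass $M:=V(\mathbb{R}^N\times G(N,m))$. Let $$\lambda_1:=\inf\left\{\frac{\int|\nabla_P u(x)|^2\,dV(x,P)}{\int_{\mathbb{R}^N}u^2\,d\|V\|}\;:\;u\in C^\infty(\mathbb{R}^N),\ \int_{\mathbb{R}^N} u^2\,d\|V\|\neq 0,\ \int_{\mathbb{R}^N}u\,d\|V\|=0\right\}.$$ Then $$\lambda_1\le\frac{\|\mathbf{H}\|^2_{L^2(d\|V\|)}}{mM}.$$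
   Context: $G(N,m)$ is the Grassmannian of unoriented $m$-dimensional linear subspaces of $\mathbb{R}^N$. An $m$-varifold $V$ in $\mathbb{R}^N$ is a Radon measure on $\mathbb{R}^N\times G(N,m)$; its weight $\|V\|$ is the Radon measure on $\mathbb{R}^N$ given by $\|V\|(\varphi)=\int\varphi(x)\,dV(x,P)$ for $\varphi\in C_c^0(\mathbb{R}^N)$. For $P\in G(N,m)$, $\pi_P$ is the orthogonal projection onto $P$, $\nabla_P u=\pi_P(\nabla u)$, and ${\rm div}_P\theta=\sum_{i=1}^m (D_{e_i}\theta)\cdot e_i$ for an orthonormal basis $(e_i)$ of $P$. The first variation of $V$ is $\delta V(\theta)=\int{\rm div}_P(\theta)(x)\,dV(x,P)$ for smooth compactly supported vector fields $\theta$ on $\mathbb{R}^N$. $V$ has locally bounded first variation if for every bounded $U$ the supremum of $|\delta V(\theta)|$ over $\theta$ supported in $U$ with $|\theta|\le1$ is finite; then $\delta V(\theta)=\int\theta\cdot\nu\,d\|\delta V\|$ for a Radon measure $\|\delta V\|$ and a field $\nu$ with $|\nu|=1$ $\|\delta V\|$-a.e. $V$ belongs to the class $H(p)$ if it has locally bounded first variation, $\|\delta V\|$ is absolutely continuous with respect to $\|V\|$, and the vector density $\mathbf{H}$ (the generalized mean curvature), defined by $\delta V(\theta)=-\int_{\mathbb{R}^N}\mathbf{H}\cdot\theta\,d\|V\|$ for all smooth compactly supported $\theta$, belongs to $L^p(\mathbb{R}^N,d\|V\|)$. $V$ is rectifiable, written $V=g\,\mathcal{H}^m|_K\otimes\delta_{TK}$,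 if $K$ is $m$-rectifiable, $g:K\to(0,+\infty)$ is $\mathcal{H}^m$-measurable, $g\mathcal{H}^m|_K$ is a Radon measure, and $\int\varphi\,dV=\int_K\varphi(x,T_xK)g(x)\,d\mathcal{H}^m(x)$ for all $\varphi\in C^0_c(\mathbb{R}^N\times G(N,m))$, with $T_xK$ the approximate tangent plane. *)

theory Defs
  imports "HOL-Analysis.Analysis"
begin

section \<open>Radon measures and compactly supported continuous functions\<close>

definition borel_of_top :: "'a topology \<Rightarrow> 'a measure" where
  "borel_of_top X = sigma (topspace X) {U. openin X U}"

definition radon_measure :: "'a topology \<Rightarrow> 'a measure \<Rightarrow> bool" where
  "radon_measure X M \<longleftrightarrow>
     space M = topspace X \<and> sets M = sets (borel_of_top X) \<and>
     (\<forall>C. compactin X C \<and> C \<in> sets M \<longrightarrow> emeasure M C < \<infinity>) \<and>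
     (\<forall>A\<in>sets M. emeasure M A = (SUP C\<in>{C. compactin X C \<and> C \<in> sets M \<and> C \<subseteq> A}. emeasure M C))"

definition cc_function :: "'a topology \<Rightarrow> ('a \<Rightarrow> real) \<Rightarrow> bool" where
  "cc_function X \<phi> \<longleftrightarrow> continuous_map X euclideanreal \<phi> \<and>
     (\<exists>C. compactin X C \<and> (\<forall>x\<in>topspace X - C. \<phi> x = 0))"


section \<open>Smooth functions\<close>

text \<open>In finite dimension a function is of class \<open>C\<close> with exponent \<open>k + 1\<close> iff it is differentiable
  and all its directional derivatives are of class \<open>C\<close> with exponent \<open>k\<close>.\<close>

fun Ck_function :: "nat \<Rightarrow> ('a::euclidean_space \<Rightarrow> 'b::real_normed_vector) \<Rightarrow> bool" where
  "Ck_function 0 f \<longleftrightarrow> continuous_on UNIV f"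
| "Ck_function (Suc k) f \<longleftrightarrow>
     (\<forall>x. f differentiable (at x)) \<and> (\<forall>v. Ck_function k (\<lambda>x. frechet_derivative f (at x) v))"

definition smooth :: "('a::euclidean_space \<Rightarrow> 'b::real_normed_vector) \<Rightarrow> bool" where
  "smooth f \<longleftrightarrow> (\<forall>k. Ck_function k f)"

definition support :: "('a::topological_space \<Rightarrow> 'b::zero) \<Rightarrow> 'a set" where
  "support f = closure {x. f x \<noteq> 0}"

definition test_field :: "(real^'n \<Rightarrow> real^'n) \<Rightarrow> bool" where
  "test_field \<theta> \<longleftrightarrow> smooth \<theta> \<and> compact (support \<theta>)"

definition gradient :: "(real^'n \<Rightarrow> real) \<Rightarrow> real^'n \<Rightarrow> real^'n" where
  "gradient u x = (THE D. GDERIV u x :> D)"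


section \<open>The Grassmannian\<close>

definition grass :: "nat \<Rightarrow> (real^'n) set set" where
  "grass m = {P. subspace P \<and> dim P = m}"

definition orth_proj :: "(real^'n) set \<Rightarrow> real^'n \<Rightarrow> real^'n" where
  "orth_proj P x = (THE y. y \<in> P \<and> (\<forall>z\<in>P. orthogonal (x - y) z))"

text \<open>The usual (compact manifold) topology of the Grassmannian is the one induced by the injection
  sending a subspace to the matrix of its orthogonal projection.\<close>

definition grass_top :: "nat \<Rightarrow> (real^'n) set topology" where
  "grass_top m = pullback_topology (grass m) (\<lambda>P. matrix (orth_proj P)) euclidean"

definition grass_bundle_top :: "nat \<Rightarrow> ((real^'n) \<times> (real^'n) set) topology" where
  "grass_bundle_top m = prod_topology euclidean (grass_top m)"

definition tangential_gradient :: "(real^'n) set \<Rightarrow> (real^'n \<Rightarrow> real) \<Rightarrow> real^'n \<Rightarrow> real^'n" where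
  "tangential_gradient P u x = orth_proj P (gradient u x)"

definition orthonormal_basis_of :: "(real^'n) set \<Rightarrow> (real^'n) set \<Rightarrow> bool" where
  "orthonormal_basis_of P B \<longleftrightarrow>
     pairwise orthogonal B \<and> (\<forall>e\<in>B. norm e = 1) \<and> span B = P"

text \<open>The value does not depend on the chosen orthonormal basis.\<close>

definition tangential_div :: "(real^'n) set \<Rightarrow> (real^'n \<Rightarrow> real^'n) \<Rightarrow> real^'n \<Rightarrow> real" where
  "tangential_div P \<theta> x =
     (\<Sum>e\<in>(SOME B. orthonormal_basis_of P B). frechet_derivative \<theta> (at x) e \<bullet> e)"


section \<open>Varifolds\<close>

definition varifold :: "nat \<Rightarrow> ((real^'n) \<times> (real^'n) set) measure \<Rightarrow> bool" where
  "varifold m V \<longleftrightarrow> radon_measure (grass_bundle_top m) V"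

definition weight :: "((real^'n) \<times> (real^'n) set) measure \<Rightarrow> (real^'n) measure" where
  "weight V = distr V borel fst"

definition first_variation ::
    "((real^'n) \<times> (real^'n) set) measure \<Rightarrow> (real^'n \<Rightarrow> real^'n) \<Rightarrow> real" where
  "first_variation V \<theta> = (\<integral>z. tangential_div (snd z) \<theta> (fst z) \<partial>V)"

definition locally_bounded_first_variation ::
    "((real^'n) \<times> (real^'n) set) measure \<Rightarrow> bool" where
  "locally_bounded_first_variation V \<longleftrightarrow>
     (\<forall>U. bounded U \<longrightarrow>
        bdd_above {\<bar>first_variation V \<theta>\<bar> | \<theta>.
          test_field \<theta> \<and> support \<theta> \<subseteq> U \<and> (\<forall>x. norm (\<theta> x) \<le> 1)})"

text \<open>\<open>\<mu>\<close> is the total variation measure of the first variation; by the Riesz representation theorem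
  it exists and is unique whenever the first variation is locally bounded.\<close>

definition total_first_variation ::
    "((real^'n) \<times> (real^'n) set) measure \<Rightarrow> (real^'n) measure \<Rightarrow> bool" where
  "total_first_variation V \<mu> \<longleftrightarrow>
     radon_measure euclidean \<mu> \<and>
     (\<exists>\<nu>. \<nu> \<in> borel_measurable borel \<and> (AE x in \<mu>. norm (\<nu> x) = 1) \<and>
        (\<forall>\<theta>. test_field \<theta> \<longrightarrow> first_variation V \<theta> = (\<integral>x. \<theta> x \<bullet> \<nu> x \<partial>\<mu>)))"

definition in_Lp :: "real \<Rightarrow> 'a measure \<Rightarrow> ('a \<Rightarrow> 'b::euclidean_space) \<Rightarrow> bool" where
  "in_Lp p \<mu> f \<longleftrightarrow> f \<in> borel_measurable \<mu> \<and> integrable \<mu> (\<lambda>x. norm (f x) powr p)"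

definition Lp_norm :: "real \<Rightarrow> 'a measure \<Rightarrow> ('a \<Rightarrow> 'b::euclidean_space) \<Rightarrow> real" where
  "Lp_norm p \<mu> f = (\<integral>x. norm (f x) powr p \<partial>\<mu>) powr (1 / p)"

text \<open>Local integrability makes \<open>H\<close> unique up to weight-null sets.\<close>

definition generalized_mean_curvature ::
    "((real^'n) \<times> (real^'n) set) measure \<Rightarrow> (real^'n \<Rightarrow> real^'n) \<Rightarrow> bool" where
  "generalized_mean_curvature V H \<longleftrightarrow>
     H \<in> borel_measurable (weight V) \<and>
     (\<forall>C. compact C \<longrightarrow> set_integrable (weight V) C H) \<and>
     (\<forall>\<theta>. test_field \<theta> \<longrightarrow> first_variation V \<theta> = - (\<integral>x. H x \<bullet> \<theta> x \<partial>weight V))"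

text \<open>\<open>V\<close> belongs to the class \<open>H(p)\<close>, for finite \<open>p\<close>, with generalized mean curvature \<open>H\<close>.\<close>

definition in_class_H ::
    "real \<Rightarrow> ((real^'n) \<times> (real^'n) set) measure \<Rightarrow> (real^'n \<Rightarrow> real^'n) \<Rightarrow> bool" where
  "in_class_H p V H \<longleftrightarrow>
     locally_bounded_first_variation V \<and>
     (\<exists>\<mu>. total_first_variation V \<mu> \<and> absolutely_continuous (weight V) \<mu>) \<and>
     generalized_mean_curvature V H \<and> in_Lp p (weight V) H"


section \<open>Hausdorff measure and rectifiability\<close>

text \<open>Normalised so that the measure agrees with Lebesgue measure on \<open>m\<close>-planes. The library's
  \<open>diameter\<close> is only meaningful for bounded sets.\<close>

definition hausdorff_pre :: "nat \<Rightarrow> real \<Rightarrow> (real^'n) set \<Rightarrow> ennreal" where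
  "hausdorff_pre m \<delta> A =
     (INF C\<in>{C :: nat \<Rightarrow> (real^'n) set.
              A \<subseteq> (\<Union>i. C i) \<and> (\<forall>i. bounded (C i) \<and> diameter (C i) \<le> \<delta>)}.
        (\<Sum>i. if C i = {} then 0
             else ennreal (unit_ball_vol (real m) * (diameter (C i) / 2) ^ m)))"

definition hausdorff_outer :: "nat \<Rightarrow> (real^'n) set \<Rightarrow> ennreal" where
  "hausdorff_outer m A = (SUP \<delta>\<in>{0<..}. hausdorff_pre m \<delta> A)"

text \<open>The sigma-algebra consists of all Caratheodory-measurable sets, not only the Borel sets.\<close>

definition hausdorff_measure :: "nat \<Rightarrow> (real^'n) measure" where
  "hausdorff_measure m =
     measure_of UNIV (lambda_system UNIV UNIV (hausdorff_outer m)) (hausdorff_outer m)"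

text \<open>Lipschitz images of Euclidean \<open>m\<close>-space are written as Lipschitz images of \<open>m\<close>-dimensional
  linear subspaces of the ambient space, which are isometric to it.\<close>

definition m_rectifiable :: "nat \<Rightarrow> (real^'n) set \<Rightarrow> bool" where
  "m_rectifiable m K \<longleftrightarrow>
     K \<in> sets (hausdorff_measure m) \<and>
     (\<exists>S (f :: nat \<Rightarrow> real^'n \<Rightarrow> real^'n). S \<in> grass m \<and> (\<forall>i. \<exists>L. L-lipschitz_on S (f i)) \<and>
        hausdorff_outer m (K - (\<Union>i. f i ` S)) = 0)"

definition weighted_hausdorff ::
    "nat \<Rightarrow> (real^'n) set \<Rightarrow> (real^'n \<Rightarrow> real) \<Rightarrow> (real^'n) measure" where
  "weighted_hausdorff m K g =
     density (hausdorff_measure m) (\<lambda>x. indicator K x * ennreal (g x))"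

text \<open>\<open>P\<close> is the approximate tangent plane of \<open>K\<close> at \<open>x\<close>, with respect to the multiplicity \<open>g\<close>: the
  blow-ups of the weighted measure at \<open>x\<close> converge to \<open>g x\<close> times the Hausdorff measure on \<open>P\<close>.\<close>

definition approx_tangent_plane ::
    "nat \<Rightarrow> (real^'n) set \<Rightarrow> (real^'n \<Rightarrow> real) \<Rightarrow> real^'n \<Rightarrow> (real^'n) set \<Rightarrow> bool" where
  "approx_tangent_plane m K g x P \<longleftrightarrow>
     P \<in> grass m \<and>
     (\<forall>\<phi>. cc_function euclidean \<phi> \<longrightarrow>
        ((\<lambda>r. (LINT z:K|hausdorff_measure m. \<phi> ((z - x) /\<^sub>R r) * g z) / r ^ m)
          \<longlongrightarrow> g x * (LINT y:P|hausdorff_measure m. \<phi> y)) (at_right 0))"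

text \<open>\<open>V\<close> is the rectifiable \<open>m\<close>-varifold with carrier \<open>K\<close> and multiplicity \<open>g\<close>. Since
  \<open>hausdorff_measure\<close> lives on a larger sigma-algebra, \<open>distr\<close> along the identity restricts the weighted
  measure to the Borel sets.\<close>

definition rectifiable_varifold ::
    "nat \<Rightarrow> ((real^'n) \<times> (real^'n) set) measure \<Rightarrow> (real^'n) set \<Rightarrow> (real^'n \<Rightarrow> real) \<Rightarrow> bool" where
  "rectifiable_varifold m V K g \<longleftrightarrow>
     varifold m V \<and> m_rectifiable m K \<and>
     (\<forall>x\<in>K. 0 < g x) \<and> g \<in> borel_measurable (restrict_space (hausdorff_measure m) K) \<and>
     radon_measure euclidean (distr (weighted_hausdorff m K g) borel (\<lambda>x. x)) \<and>
     (\<exists>T. (AE x in weighted_hausdorff m K g. approx_tangent_plane m K g x (T x)) \<and>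
        (\<forall>\<phi>. cc_function (grass_bundle_top m) \<phi> \<longrightarrow>
           (\<integral>z. \<phi> z \<partial>V) = (LINT x:K|hausdorff_measure m. \<phi> (x, T x) * g x)))"


section \<open>The first eigenvalue\<close>

text \<open>The infimum is taken in the extended reals, so that no convention for the empty set is hidden.\<close>

definition lambda1 :: "((real^'n) \<times> (real^'n) set) measure \<Rightarrow> ereal" where
  "lambda1 V =
     Inf {ereal ((\<integral>z. (norm (tangential_gradient (snd z) u (fst z)))\<^sup>2 \<partial>V)
                  / (\<integral>x. (u x)\<^sup>2 \<partial>weight V)) | u :: real^'n \<Rightarrow> real.
            smooth u \<and> (\<integral>x. (u x)\<^sup>2 \<partial>weight V) \<noteq> 0 \<and> (\<integral>x. u x \<partial>weight V) = 0}"

end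

theory Submission
  imports Defs "HOL-Computational_Algebra.Polynomial"
begin

text \<open>The test functions are the centred coordinates \<open>x\<^sub>i - c\<^sub>i\<close>. Their tangential gradients are the
  projections of the coordinate vectors, so the Dirichlet energies add up to
  \<open>\<integral> trace \<pi>\<^sub>P dV = m M\<close>, while the denominators add up to \<open>I = \<integral> |x - c|\<^sup>2 d\<parallel>V\<parallel>\<close>; hence
  \<open>\<lambda>\<^sub>1 \<le> m M / I\<close>. Testing the first variation with \<open>x - c\<close>, whose tangential divergence is \<open>m\<close>,
  gives \<open>m M = - \<integral> H \<bullet> (x - c) d\<parallel>V\<parallel>\<close>, and Cauchy-Schwarz bounds \<open>(m M)\<^sup>2\<close> by \<open>\<parallel>H\<parallel>\<^sup>2 I\<close>. Two points need
  work: \<open>x - c\<close> must be cut off smoothly, and \<open>V\<close> must be shown to live over a bounded set, which uses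
  compactness of the Grassmannian since only compactly supported functions are tested.\<close>

section \<open>Calculus of smooth functions\<close>

text \<open>Lets a derivative be exhibited by a formula: uniqueness identifies it with the
  \<open>frechet_derivative\<close> of the recursive clause.\<close>

lemma Ck_function_SucI:
  assumes "\<And>x. (f has_derivative f' x) (at x)" and "\<And>v. Ck_function k (\<lambda>x. f' x v)"
  shows "Ck_function (Suc k) f"
proof -
  have "frechet_derivative f (at x) = f' x" for x
    using frechet_derivative_at[OF assms(1)] by simp
  with assms show ?thesis by (auto simp: differentiable_def)
qed

lemma Ck_function_Suc_derivative:
  assumes "Ck_function (Suc k) f"
  shows "(f has_derivative frechet_derivative f (at x)) (at x)"
  using assms by (simp add: frechet_derivative_works)

lemma Ck_function_SucD: "Ck_function (Suc k) f \<Longrightarrow> Ck_function k f"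
proof (induction k arbitrary: f)
  case 0
  then show ?case
    by (auto simp: continuous_on_eq_continuous_at differentiable_imp_continuous_within)
next
  case (Suc k)
  then show ?case by (metis Ck_function.simps(2))
qed

lemma Ck_function_const: "Ck_function k (\<lambda>x. c)"
proof (induction k arbitrary: c)
  case (Suc k)
  then show ?case by (auto intro!: Ck_function_SucI[where f' = "\<lambda>_ _. 0"])
qed auto

lemma Ck_function_bounded_linear:
  assumes "bounded_linear f"
  shows "Ck_function k f"
proof (cases k)
  case 0
  then show ?thesis using assms by (simp add: linear_continuous_on)
next
  case (Suc j)
  then show ?thesis
    unfolding Suc
    by (intro Ck_function_SucI[where f' = "\<lambda>_. f"] Ck_function_const
        bounded_linear_imp_has_derivative assms)
qed

lemma Ck_function_add:
  assumes "Ck_function k f" and "Ck_function k g"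
  shows "Ck_function k (\<lambda>x. f x + g x)"
  using assms
proof (induction k arbitrary: f g)
  case 0
  then show ?case by (auto intro: continuous_intros)
next
  case (Suc k)
  show ?case
  proof (rule Ck_function_SucI)
    show "((\<lambda>x. f x + g x) has_derivative
        (\<lambda>v. frechet_derivative f (at x) v + frechet_derivative g (at x) v)) (at x)" for x
      using Suc.prems by (intro has_derivative_add Ck_function_Suc_derivative)
    show "Ck_function k (\<lambda>x. frechet_derivative f (at x) v + frechet_derivative g (at x) v)" for v
      using Suc by simp
  qed
qed

text \<open>One proof serves multiplication, scaling and the inner product. The product rule leaves
  one factor undifferentiated, so the induction lowers the order of that factor by
  \<open>Ck_function_SucD\<close>.\<close>

lemma (in bounded_bilinear) Ck_function:
  assumes "Ck_function k f" and "Ck_function k g"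
  shows "Ck_function k (\<lambda>x. prod (f x) (g x))"
  using assms
proof (induction k arbitrary: f g)
  case 0
  then show ?case by (auto intro: continuous_on)
next
  case (Suc k)
  show ?case
  proof (rule Ck_function_SucI)
    show "((\<lambda>x. prod (f x) (g x)) has_derivative
        (\<lambda>v. prod (f x) (frechet_derivative g (at x) v) + prod (frechet_derivative f (at x) v) (g x)))
        (at x)" for x
      using Suc.prems by (intro FDERIV Ck_function_Suc_derivative)
    show "Ck_function k (\<lambda>x. prod (f x) (frechet_derivative g (at x) v)
        + prod (frechet_derivative f (at x) v) (g x))" for v
      using Suc.prems Suc.prems[THEN Ck_function_SucD] by (intro Ck_function_add Suc.IH) auto
  qed
qed

text \<open>Derivatives of \<open>exp (- 1 / t)\<close> stay in this family: differentiating replaces \<open>p\<close> by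
  \<open>X\<^sup>2 (p - p')\<close>.\<close>

definition flat_exp :: "real poly \<Rightarrow> real \<Rightarrow> real" where
  "flat_exp p t = (if t > 0 then poly p (1 / t) * exp (- (1 / t)) else 0)"

lemma poly_over_exp_tendsto_0: "((\<lambda>s. poly p s / exp s) \<longlongrightarrow> 0) at_top" for p :: "real poly"
proof -
  have "((\<lambda>s. \<Sum>i\<le>degree p. coeff p i * (s ^ i / exp s)) \<longlongrightarrow> (\<Sum>i\<le>degree p. coeff p i * 0)) at_top"
    by (intro tendsto_intros tendsto_power_div_exp_0)
  then show ?thesis by (simp add: poly_altdef sum_divide_distrib)
qed

text \<open>On the right, substituting \<open>s = 1 / t\<close> sets a polynomial in
  \<open>s\<close> against \<open>exp s\<close> at infinity.\<close>

lemma flat_exp_tendsto_0: "(flat_exp p \<longlongrightarrow> 0) (at 0)"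
proof (rule filterlim_split_at)
  show "(flat_exp p \<longlongrightarrow> 0) (at_left 0)"
    by (rule tendsto_eventually)
      (auto simp: flat_exp_def eventually_at_filter)
  have "((\<lambda>t. poly p (inverse t) / exp (inverse t)) \<longlongrightarrow> 0) (at_right 0)"
    using filterlim_compose[OF poly_over_exp_tendsto_0 filterlim_inverse_at_top_right] .
  then show "(flat_exp p \<longlongrightarrow> 0) (at_right 0)"
    by (rule Lim_transform_eventually)
      (auto simp: flat_exp_def eventually_at_filter exp_minus field_simps)
qed

lemma flat_exp_has_derivative:
  "(flat_exp p has_real_derivative flat_exp ([:0, 0, 1:] * (p - pderiv p)) t) (at t)"
proof -
  consider "t > 0" | "t < 0" | "t = 0" by linarith
  then show ?thesis
  proof cases
    case 1
    have "((\<lambda>t. poly p (1 / t) * exp (- (1 / t))) has_real_derivative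
        flat_exp ([:0, 0, 1:] * (p - pderiv p)) t) (at t)"
      using 1 by (auto intro!: derivative_eq_intros DERIV_chain'[OF _ poly_DERIV]
          simp: flat_exp_def field_simps power2_eq_square)
    then show ?thesis
      by (rule has_field_derivative_transform_within_open[where S = "{0<..}"])
        (use 1 in \<open>auto simp: flat_exp_def\<close>)
  next
    case 2
    have "((\<lambda>t. 0) has_real_derivative flat_exp ([:0, 0, 1:] * (p - pderiv p)) t) (at t)"
      using 2 by (auto simp: flat_exp_def)
    then show ?thesis
      by (rule has_field_derivative_transform_within_open[where S = "{..<0}"])
        (use 2 in \<open>auto simp: flat_exp_def\<close>)
  next
    case 3
    \<comment> \<open>The difference quotient at 0 stays in the family: dividing by \<open>h\<close>
      multiplies the polynomial by \<open>X\<close>.\<close>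
    have "((\<lambda>h. (flat_exp p (0 + h) - flat_exp p 0) / h) \<longlongrightarrow> 0) (at 0)"
      using flat_exp_tendsto_0[of "[:0, 1:] * p"]
      by (rule Lim_transform_eventually)
        (auto simp: flat_exp_def eventually_at_filter field_simps)
    then show ?thesis using 3 by (simp add: DERIV_def flat_exp_def)
  qed
qed

text \<open>The induction generalises \<open>p\<close> because the chain rule replaces it. The inner
  function \<open>q\<close> makes the result reusable for the nested cut-off factor.\<close>

lemma Ck_function_flat_exp:
  assumes "Ck_function k q"
  shows "Ck_function k (\<lambda>x. flat_exp p (q x))"
  using assms
proof (induction k arbitrary: p)
  case 0
  have "continuous_on UNIV (flat_exp p)"
    using flat_exp_has_derivative DERIV_isCont by (blast intro: continuous_at_imp_continuous_on)
  with 0 show ?case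
    by (auto intro: continuous_on_compose2)
next
  case (Suc k)
  let ?p' = "[:0, 0, 1:] * (p - pderiv p)"
  show ?case
  proof (rule Ck_function_SucI)
    show "((\<lambda>x. flat_exp p (q x)) has_derivative
        (\<lambda>v. flat_exp ?p' (q x) * frechet_derivative q (at x) v)) (at x)" for x
      using has_derivative_compose[OF Ck_function_Suc_derivative[OF Suc.prems, of x]
          flat_exp_has_derivative[unfolded has_field_derivative_def]] .
    show "Ck_function k (\<lambda>x. flat_exp ?p' (q x) * frechet_derivative q (at x) v)" for v
      using Suc.prems Ck_function_SucD[OF Suc.prems]
      by (intro bounded_bilinear.Ck_function[OF bounded_bilinear_mult] Suc.IH) auto
  qed
qed

text \<open>With \<open>F t = exp (- 1 / t)\<close> extended by \<open>0\<close>, the field is \<open>F (F 1 - F (|x|\<^sup>2 - r\<^sup>2)) / F (F 1)\<close>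
  times \<open>x - c\<close>; the factor is \<open>1\<close> for \<open>|x| \<le> r\<close> and \<open>0\<close> for \<open>|x|\<^sup>2 \<ge> r\<^sup>2 + 1\<close>.\<close>

lemma ex_test_field_eq_translation_on_ball:
  fixes c :: "real^'n"
  obtains \<theta> :: "real^'n \<Rightarrow> real^'n"
    where "test_field \<theta>" and "\<And>x. norm x \<le> r \<Longrightarrow> \<theta> x = x - c"
proof
  define F where "F = flat_exp 1"
  define bump where "bump x = F (F 1 - F (x \<bullet> x - r\<^sup>2)) / F (F 1)" for x :: "real^'n"
  define \<theta> where "\<theta> x = bump x *\<^sub>R (x - c)" for x
  have F_pos: "F t > 0 \<longleftrightarrow> t > 0" and F_0: "F t = 0 \<longleftrightarrow> t \<le> 0" for t
    by (auto simp: F_def flat_exp_def)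
  have F_ge: "F 1 \<le> F t" if "t \<ge> 1" for t
    using that by (auto simp: F_def flat_exp_def field_simps)
  \<comment> \<open>Differences and quotients are written so that the closure rules match.\<close>
  have "Ck_function k (\<lambda>x::real^'n. (F (F 1 + (-1) * F (x \<bullet> x + - r\<^sup>2)) * (1 / F (F 1))) *\<^sub>R (x + - c))" for k
    unfolding F_def
    by (intro Ck_function_add Ck_function_const Ck_function_flat_exp
        bounded_bilinear.Ck_function[OF bounded_bilinear_mult]
        bounded_bilinear.Ck_function[OF bounded_bilinear_scaleR]
        bounded_bilinear.Ck_function[OF bounded_bilinear_inner]
        Ck_function_bounded_linear bounded_linear_ident)
  then have "smooth \<theta>"
    by (simp add: smooth_def \<theta>_def[abs_def] bump_def[abs_def])
  moreover have "support \<theta> \<subseteq> cball 0 (sqrt (r\<^sup>2 + 1))"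
    unfolding support_def
  proof (rule closure_minimal)
    show "{x. \<theta> x \<noteq> 0} \<subseteq> cball 0 (sqrt (r\<^sup>2 + 1))"
    proof safe
      fix x :: "real^'n" assume "\<theta> x \<noteq> 0"
      then have "F (F 1 - F (x \<bullet> x - r\<^sup>2)) \<noteq> 0" by (auto simp: \<theta>_def bump_def)
      then have "\<not> x \<bullet> x - r\<^sup>2 \<ge> 1" using F_ge[of "x \<bullet> x - r\<^sup>2"] F_0 by auto
      then show "x \<in> cball 0 (sqrt (r\<^sup>2 + 1))"
        by (auto simp: norm_eq_sqrt_inner)
    qed
  qed simp
  then have "compact (support \<theta>)"
    by (metis compact_Int_closed compact_cball closed_closure inf.absorb2 support_def)
  ultimately show "test_field \<theta>" by (simp add: test_field_def)
  show "\<theta> x = x - c" if "norm x \<le> r" for x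
  proof -
    have "(norm x)\<^sup>2 \<le> r\<^sup>2" using that by (intro power_mono) auto
    then have "F (x \<bullet> x - r\<^sup>2) = 0" by (simp add: F_0 power2_norm_eq_inner)
    moreover have "F (F 1) > 0" by (simp add: F_pos)
    ultimately show ?thesis by (simp add: \<theta>_def bump_def)
  qed
qed

section \<open>The Grassmannian\<close>

text \<open>Two candidates differ by a vector of \<open>P\<close> that is orthogonal to
  \<open>P\<close>, hence to itself.\<close>

lemma orth_proj_eqI:
  assumes "subspace P" "y \<in> P" "\<And>z. z \<in> P \<Longrightarrow> orthogonal (x - y) z"
  shows "orth_proj P x = y"
  unfolding orth_proj_def
proof (rule the_equality)
  fix w assume w: "w \<in> P \<and> (\<forall>z\<in>P. orthogonal (x - w) z)"
  then have "w - y \<in> P" using assms by (simp add: subspace_diff)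
  then have "(w - y) \<bullet> (w - y) = 0"
    using assms(3)[of "w - y"] w by (auto simp: orthogonal_def inner_diff_left)
  then show "w = y" by simp
qed (use assms in auto)

text \<open>Unit vectors are nonzero, so orthogonality gives independence, which yields finiteness
  and the cardinality.\<close>

lemma orthonormal_basis_ofD:
  assumes "orthonormal_basis_of P B"
  shows "finite B" "card B = dim P" "\<And>b. b \<in> B \<Longrightarrow> b \<bullet> b = 1" "subspace P"
    "\<And>b b'. b \<in> B \<Longrightarrow> b' \<in> B \<Longrightarrow> b \<noteq> b' \<Longrightarrow> b \<bullet> b' = 0" "span B = P"
proof -
  have "0 \<notin> B" using assms by (auto simp: orthonormal_basis_of_def)
  then have ind: "independent B"
    using assms by (intro pairwise_orthogonal_independent) (auto simp: orthonormal_basis_of_def)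
  then show "finite B" by (rule independent_imp_finite)
  show "span B = P" using assms by (simp add: orthonormal_basis_of_def)
  then show "card B = dim P" using ind by (metis dim_span_eq_card_independent dim_span)
qed (use assms in \<open>auto simp: orthonormal_basis_of_def pairwise_def orthogonal_def norm_eq_1\<close>)

lemma orthonormal_basis_of_ex:
  assumes "subspace P"
  obtains B where "orthonormal_basis_of P B"
  by (rule orthonormal_basis_subspace[OF assms]) (auto simp: orthonormal_basis_of_def)

lemma orthonormal_basis_sum_mem:
  assumes "orthonormal_basis_of P B"
  shows "(\<Sum>b\<in>B. f b *\<^sub>R b) \<in> P"
proof -
  have "b \<in> P" if "b \<in> B" for b
    using orthonormal_basis_ofD(6)[OF assms] that by (auto intro: span_base)
  then show ?thesis
    using orthonormal_basis_ofD(4)[OF assms] by (intro subspace_sum subspace_scale)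
qed

lemma orthonormal_basis_sum_orthogonal:
  assumes "orthonormal_basis_of P B" and "z \<in> P"
  shows "orthogonal (x - (\<Sum>b\<in>B. (x \<bullet> b) *\<^sub>R b)) z"
proof -
  note B = orthonormal_basis_ofD[OF assms(1)]
  have "z \<in> span B" using B assms by simp
  then show ?thesis
  proof (rule orthogonal_to_span)
    fix b assume b: "b \<in> B"
    have "(\<Sum>b'\<in>B. (x \<bullet> b') * (b' \<bullet> b)) = (\<Sum>b'\<in>B. if b' = b then x \<bullet> b else 0)"
      using B b by (intro sum.cong) auto
    with b B show "orthogonal (x - (\<Sum>b\<in>B. (x \<bullet> b) *\<^sub>R b)) b"
      by (simp add: orthogonal_def inner_diff_left inner_sum_left)
  qed
qed

lemma orth_proj_eq_sum:
  assumes "orthonormal_basis_of P B"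
  shows "orth_proj P x = (\<Sum>b\<in>B. (x \<bullet> b) *\<^sub>R b)"
  using assms orthonormal_basis_ofD(4)
  by (intro orth_proj_eqI orthonormal_basis_sum_mem orthonormal_basis_sum_orthogonal)

lemma
  assumes "subspace P"
  shows orth_proj_mem: "orth_proj P x \<in> P"
    and orth_proj_orthogonal: "z \<in> P \<Longrightarrow> orthogonal (x - orth_proj P x) z"
    and linear_orth_proj: "linear (orth_proj P)"
    and orth_proj_commute: "orth_proj P x \<bullet> y = x \<bullet> orth_proj P y"
proof -
  obtain B where B: "orthonormal_basis_of P B" using orthonormal_basis_of_ex[OF assms] .
  note eq = orth_proj_eq_sum[OF B]
  show "orth_proj P x \<in> P" unfolding eq by (rule orthonormal_basis_sum_mem[OF B])
  show "orthogonal (x - orth_proj P x) z" if "z \<in> P"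
    unfolding eq by (rule orthonormal_basis_sum_orthogonal[OF B that])
  show "linear (orth_proj P)"
    unfolding eq[abs_def]
    by (rule linearI) (auto simp: inner_add_left scaleR_add_left sum.distrib scaleR_sum_right)
  show "orth_proj P x \<bullet> y = x \<bullet> orth_proj P y"
    by (simp add: eq inner_sum_left inner_sum_right inner_commute mult.commute)
qed

lemma orth_proj_inner:
  assumes "subspace P"
  shows "orth_proj P x \<bullet> orth_proj P y = orth_proj P x \<bullet> y"
  using orth_proj_orthogonal[OF assms orth_proj_mem[OF assms], of y x]
  by (simp add: orthogonal_def inner_diff_left inner_commute[of "orth_proj P x"])

text \<open>The sum is the trace of the projection. Expanding in an orthonormal basis
  \<open>B\<close> of \<open>P\<close> and exchanging the sums leaves
  \<open>b \<bullet> b = 1\<close> for each \<open>b\<close> in \<open>B\<close>.\<close>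

lemma sum_norm_orth_proj_axis:
  fixes P :: "(real^'n) set"
  assumes "subspace P"
  shows "(\<Sum>i\<in>UNIV. (norm (orth_proj P (axis i 1)))\<^sup>2) = dim P"
proof -
  obtain B where B: "orthonormal_basis_of P B" using orthonormal_basis_of_ex[OF assms] .
  note B' = orthonormal_basis_ofD[OF B]
  have "(norm (orth_proj P (axis i 1)))\<^sup>2 = (\<Sum>b\<in>B. b $ i * b $ i)" for i
  proof -
    have "(norm (orth_proj P (axis i 1)))\<^sup>2 = orth_proj P (axis i 1) \<bullet> axis i 1"
      by (simp add: power2_norm_eq_inner orth_proj_inner[OF assms])
    also have "\<dots> = (\<Sum>b\<in>B. b $ i * b $ i)"
      by (simp add: orth_proj_eq_sum[OF B] inner_sum_left inner_axis inner_axis')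
    finally show ?thesis .
  qed
  then have "(\<Sum>i\<in>UNIV. (norm (orth_proj P (axis i 1)))\<^sup>2) = (\<Sum>b\<in>B. b \<bullet> b)"
    by (simp add: inner_vec_def sum.swap[of _ B])
  also have "\<dots> = dim P" using B' by simp
  finally show ?thesis .
qed

text \<open>The right-hand side is visibly closed, and \<open>A \<bullet> A = trace (A A\<^sup>T) = m\<close> makes it bounded.\<close>

lemma image_grass_eq:
  "(\<lambda>P. matrix (orth_proj P)) ` grass m =
     {A :: real^'n^'n. transpose A = A \<and> A ** A = A \<and> trace A = real m}"
proof (intro equalityI subsetI)
  fix A :: "real^'n^'n" assume "A \<in> (\<lambda>P. matrix (orth_proj P)) ` grass m"
  then obtain P where P: "subspace P" "dim P = m" and A: "A = matrix (orth_proj P)"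
    by (auto simp: grass_def)
  have A_mult: "A *v x = orth_proj P x" for x
    using linear_orth_proj[OF P(1)] by (simp add: A matrix_works linear_matrix_vector_mul_eq)
  have A_nth: "A $ i $ j = orth_proj P (axis j 1) \<bullet> axis i 1" for i j
    by (simp add: A matrix_def inner_axis)
  have "transpose A = A"
    by (simp add: vec_eq_iff transpose_def A_nth) (metis P(1) orth_proj_commute inner_commute)
  moreover have "A ** A = A"
  proof -
    have "orth_proj P (orth_proj P x) = orth_proj P x" for x
      by (intro orth_proj_eqI P orth_proj_mem) (simp add: orthogonal_def)
    then show ?thesis
      by (simp add: matrix_eq matrix_vector_mul_assoc[symmetric] A_mult)
  qed
  moreover have "trace A = (\<Sum>i\<in>UNIV. (norm (orth_proj P (axis i 1)))\<^sup>2)"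
    by (simp add: trace_def A_nth power2_norm_eq_inner orth_proj_inner[OF P(1)])
  ultimately show "A \<in> {A. transpose A = A \<and> A ** A = A \<and> trace A = real m}"
    by (simp add: sum_norm_orth_proj_axis P)
next
  fix A :: "real^'n^'n" assume "A \<in> {A. transpose A = A \<and> A ** A = A \<and> trace A = real m}"
  then have A: "transpose A = A" "A ** A = A" "trace A = real m" by auto
  \<comment> \<open>A symmetric idempotent projects onto its range: \<open>A\<close> annihilates
    \<open>x - A *v x\<close>, and symmetry moves \<open>A\<close> across the inner product.\<close>
  define P where "P = range ((*v) A)"
  have P: "subspace P" unfolding P_def
    by (intro linear_subspace_image) auto
  have proj: "orth_proj P x = A *v x" for x
  proof (rule orth_proj_eqI[OF P])
    fix z assume "z \<in> P"
    then obtain w where "z = A *v w" by (auto simp: P_def)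
    then have "(x - A *v x) \<bullet> z = (transpose A *v (x - A *v x)) \<bullet> w"
      by (simp add: dot_lmul_matrix transpose_matrix_vector)
    also have "transpose A *v (x - A *v x) = 0"
      by (simp add: A matrix_vector_mult_diff_distrib matrix_vector_mul_assoc)
    finally show "orthogonal (x - A *v x) z" by (simp add: orthogonal_def)
  qed (auto simp: P_def)
  then have mat: "matrix (orth_proj P) = A" by (simp add: proj[abs_def])
  have "trace A = (\<Sum>i\<in>UNIV. (norm (orth_proj P (axis i 1)))\<^sup>2)"
    by (simp add: trace_def power2_norm_eq_inner orth_proj_inner[OF P])
      (simp add: proj inner_axis matrix_vector_mult_basis column_def)
  then have "dim P = m" using A by (simp add: sum_norm_orth_proj_axis P)
  with P mat show "A \<in> (\<lambda>P. matrix (orth_proj P)) ` grass m" by (auto simp: grass_def)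
qed

section \<open>Topology and compactness of the Grassmannian\<close>

lemma topspace_grass_top [simp]: "topspace (grass_top m) = grass m"
  by (simp add: grass_top_def topspace_pullback_topology)

lemma topspace_grass_bundle_top [simp]: "topspace (grass_bundle_top m) = UNIV \<times> grass m"
  by (simp add: grass_bundle_top_def)

lemma compact_image_grass: "compact ((\<lambda>P. matrix (orth_proj P)) ` grass m :: (real^'n^'n) set)"
proof -
  have "closed {A :: real^'n^'n. transpose A = A \<and> A ** A = A \<and> trace A = real m}"
    unfolding transpose_def trace_def matrix_matrix_mult_def vec_eq_iff
    by (intro closed_Collect_conj closed_Collect_all closed_Collect_eq continuous_intros)
  moreover have "norm A = sqrt m" if "transpose A = A" "A ** A = A" "trace A = real m" for A :: "real^'n^'n"
  proof -
    have "A \<bullet> A = (\<Sum>i\<in>UNIV. (A ** transpose A) $ i $ i)"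
      by (simp add: inner_vec_def matrix_matrix_mult_def transpose_def)
    also have "\<dots> = real m" using that by (simp add: trace_def)
    finally show ?thesis by (simp add: norm_eq_sqrt_inner)
  qed
  then have "bounded {A :: real^'n^'n. transpose A = A \<and> A ** A = A \<and> trace A = real m}"
    by (auto simp: bounded_iff intro!: exI[of _ "sqrt m"])
  ultimately show ?thesis by (simp add: compact_eq_bounded_closed image_grass_eq)
qed

text \<open>Open sets of the pullback are traces on \<open>A\<close> of preimages of open sets of
  \<open>T\<close>, so a cover of \<open>A\<close> induces a cover of its image, and a finite
  subcover pulls back.\<close>

lemma compact_space_pullback_topology:
  assumes "compactin T (f ` A)"
  shows "compact_space (pullback_topology A f T)"
  unfolding compact_space topspace_pullback_topology
proof safe
  have sub: "f ` A \<subseteq> topspace T" using assms by (rule compactin_subset_topspace)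
  fix \<U> assume op: "\<forall>U\<in>\<U>. openin (pullback_topology A f T) U"
    and cov: "\<Union>\<U> = f -` topspace T \<inter> A"
  have "\<forall>U\<in>\<U>. \<exists>W. openin T W \<and> U = f -` W \<inter> A"
    using op by (simp add: openin_pullback_topology)
  then obtain W where W: "\<And>U. U \<in> \<U> \<Longrightarrow> openin T (W U) \<and> U = f -` W U \<inter> A" by metis
  have cov': "f ` A \<subseteq> \<Union>(W ` \<U>)"
  proof (rule image_subsetI)
    fix a assume a: "a \<in> A"
    then have "a \<in> \<Union>\<U>" unfolding cov using sub by auto
    then obtain U where "U \<in> \<U>" "a \<in> U" by (rule UnionE)
    then show "f a \<in> \<Union>(W ` \<U>)" using W[of U] by auto
  qed
  moreover have "openin T X" if "X \<in> W ` \<U>" for X using that W by auto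
  ultimately obtain \<F> where F: "finite \<F>" "\<F> \<subseteq> W ` \<U>" "f ` A \<subseteq> \<Union>\<F>"
    using compactinD[OF assms, of "W ` \<U>"] by metis
  from finite_subset_image[OF F(1,2)] obtain \<G> where G: "\<G> \<subseteq> \<U>" "finite \<G>" "\<F> = W ` \<G>"
    by auto
  have "\<Union>\<G> = f -` topspace T \<inter> A"
  proof
    show "\<Union>\<G> \<subseteq> f -` topspace T \<inter> A" unfolding cov[symmetric] using G(1) by (rule Union_mono)
    show "f -` topspace T \<inter> A \<subseteq> \<Union>\<G>"
    proof
      fix a assume "a \<in> f -` topspace T \<inter> A"
      then have a: "a \<in> A" by simp
      then have "f a \<in> \<Union>(W ` \<G>)" using F(3) G(3) by auto
      then obtain U where U: "U \<in> \<G>" "f a \<in> W U" by auto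
      then have "a \<in> U" using a W[of U] G(1) by auto
      with U(1) show "a \<in> \<Union>\<G>" by auto
    qed
  qed
  with G(1,2) show "\<exists>\<F>. finite \<F> \<and> \<F> \<subseteq> \<U> \<and> \<Union>\<F> = f -` topspace T \<inter> A" by auto
qed

text \<open>Makes a closed ball times the Grassmannian compact, so that a function of the base point
  alone can be an admissible test function on the bundle.\<close>

lemma compactin_grass: "compactin (grass_top m) (grass m)"
proof -
  have "compact_space (grass_top m)"
    unfolding grass_top_def
    by (intro compact_space_pullback_topology) (simp add: compact_image_grass)
  then show ?thesis by (simp add: compact_space_def)
qed

section \<open>Varifolds\<close>

lemma sets_borel_of_top: "sets (borel_of_top X) = sigma_sets (topspace X) {U. openin X U}"
  unfolding borel_of_top_def by (intro sets_measure_of) (auto dest: openin_subset)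

lemma radon_measure_measurable:
  fixes f :: "'a \<Rightarrow> 'b::topological_space"
  assumes "radon_measure X M" and "continuous_map X euclidean f"
  shows "f \<in> borel_measurable M"
proof (rule borel_measurableI)
  fix S :: "'b set" assume "open S"
  then have "openin X {x \<in> topspace X. f x \<in> S}"
    using assms(2) by (auto simp: continuous_map_def)
  moreover have "f -` S \<inter> space M = {x \<in> topspace X. f x \<in> S}"
    using assms(1) by (auto simp: radon_measure_def)
  ultimately show "f -` S \<inter> space M \<in> sets M"
    using assms(1) by (simp add: radon_measure_def sets_borel_of_top)
qed

lemma varifold_space: "varifold m V \<Longrightarrow> space V = UNIV \<times> grass m"
  by (simp add: varifold_def radon_measure_def)

lemma continuous_map_fst_grass_bundle: "continuous_map (grass_bundle_top m) euclidean fst"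
  by (simp add: grass_bundle_top_def continuous_map_fst)

lemma varifold_measurable_fst: "varifold m V \<Longrightarrow> fst \<in> borel_measurable V"
  unfolding varifold_def by (rule radon_measure_measurable[OF _ continuous_map_fst_grass_bundle])

text \<open>The topology is pulled back along the projection matrix, so the columns of that matrix
  depend continuously on the plane. They are identified with values of \<open>orth_proj\<close> on
  the space of \<open>V\<close>, where the second component is a subspace and
  \<open>orth_proj\<close> is linear.\<close>

lemma varifold_measurable_orth_proj_axis:
  assumes "varifold m V"
  shows "(\<lambda>z. orth_proj (snd z) (axis i 1)) \<in> borel_measurable V"
proof -
  have "continuous_map (grass_bundle_top m) (grass_top m) snd"
    by (simp add: grass_bundle_top_def continuous_map_snd)
  then have "continuous_map (grass_bundle_top m) euclidean (\<lambda>z. matrix (orth_proj (snd z)))"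
    using continuous_map_compose[of "grass_bundle_top m" "grass_top m" snd euclidean "\<lambda>P. matrix (orth_proj P)"]
      continuous_map_pullback[of euclidean euclidean id "grass m" "\<lambda>P. matrix (orth_proj P)"]
    by (simp add: grass_top_def o_def)
  then have "(\<lambda>z. matrix (orth_proj (snd z))) \<in> borel_measurable V"
    using assms radon_measure_measurable varifold_def by blast
  then have "(\<lambda>z. matrix (orth_proj (snd z)) *v axis i 1) \<in> borel_measurable V"
    by (rule borel_measurable_continuous_on[rotated])
      (simp add: matrix_vector_mult_def continuous_intros)
  then show ?thesis
    by (rule measurable_cong[THEN iffD1, rotated])
      (auto simp: varifold_space[OF assms] grass_def linear_orth_proj matrix_works)
qed

text \<open>Test functions supported in the shells \<open>r < norm x < k\<close> integrate to 0 over
  \<open>K\<close>, hence against \<open>V\<close>, so each shell is null. Countably many shells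
  exhaust the complement of the ball.\<close>

lemma rectifiable_varifold_AE_bounded:
  assumes rect: "rectifiable_varifold m V K g" and K: "K \<subseteq> cball 0 r" and fin: "finite_measure V"
  shows "AE z in V. norm (fst z) \<le> r"
proof -
  interpret finite_measure V by fact
  have vf: "varifold m V" using rect by (simp add: rectifiable_varifold_def)
  note [measurable] = varifold_measurable_fst[OF vf]
  have "AE z in V. \<not> (r < norm (fst z) \<and> norm (fst z) < real k)" for k :: nat
  proof -
    \<comment> \<open>A tent in the norm of the base point, positive exactly on the shell. The inner
      slope makes it vanish on \<open>K\<close>; the outer one gives it compact support.\<close>
    define \<phi> where "\<phi> z = max 0 (min (norm (fst z) - r) (real k - norm (fst z)))"
      for z :: "(real^'a) \<times> (real^'a) set"
    have "cc_function (grass_bundle_top m) \<phi>"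
      unfolding cc_function_def
    proof (intro conjI exI)
      show "continuous_map (grass_bundle_top m) euclideanreal \<phi>"
        unfolding \<phi>_def
        by (intro continuous_map_real_max continuous_map_real_min continuous_map_diff
            continuous_map_norm continuous_map_fst_grass_bundle) auto
      show "compactin (grass_bundle_top m) (cball 0 (real k) \<times> grass m)"
        by (simp add: grass_bundle_top_def compactin_Times compactin_grass)
      show "\<forall>x\<in>topspace (grass_bundle_top m) - cball 0 (real k) \<times> grass m. \<phi> x = 0"
        by (auto simp: \<phi>_def)
    qed
    then obtain T where "(\<integral>z. \<phi> z \<partial>V) = (LINT x:K|hausdorff_measure m. \<phi> (x, T x) * g x)"
      using rect by (auto simp: rectifiable_varifold_def)
    also have "\<dots> = integral\<^sup>L (hausdorff_measure m :: (real^'a) measure) (\<lambda>x. 0)"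
      unfolding set_lebesgue_integral_def
      by (intro Bochner_Integration.integral_cong) (use K in \<open>auto simp: \<phi>_def indicator_def\<close>)
    finally have "(\<integral>z. \<phi> z \<partial>V) = 0" by simp
    \<comment> \<open>Integrability is essential: the Bochner integral of a non-integrable function
      is 0 by default, so a vanishing integral alone says nothing.\<close>
    moreover have "integrable V \<phi>"
    proof (rule integrable_const_bound)
      have "\<bar>\<phi> z\<bar> \<le> real k" for z
        unfolding \<phi>_def using norm_ge_zero[of "fst z"] by linarith
      then show "AE z in V. norm (\<phi> z) \<le> real k" by simp
      show "\<phi> \<in> borel_measurable V" unfolding \<phi>_def[abs_def] by measurable
    qed
    ultimately have "AE z in V. \<phi> z = 0"
      by (subst (asm) integral_nonneg_eq_0_iff_AE) (auto simp: \<phi>_def)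
    then show ?thesis by eventually_elim (auto simp: \<phi>_def)
  qed
  then have "AE z in V. \<forall>k::nat. \<not> (r < norm (fst z) \<and> norm (fst z) < real k)"
    by (intro AE_all_countable[THEN iffD2] allI)
  then show ?thesis
    by eventually_elim (metis not_le_imp_less reals_Archimedean2)
qed

text \<open>The strict bound on \<open>x\<close> leaves a neighbourhood where
  \<open>\<theta>\<close> is a translation, so its derivative at \<open>x\<close> is the identity
  and each of the \<open>m\<close> basis vectors contributes 1.\<close>

lemma tangential_div_translation_on_ball:
  fixes \<theta> :: "real^'n \<Rightarrow> real^'n"
  assumes P: "P \<in> grass m" and \<theta>: "\<And>y. norm y < r \<Longrightarrow> \<theta> y = y - c" and x: "norm x < r"
  shows "tangential_div P \<theta> x = real m"
proof -
  have "((\<lambda>y. y - c) has_derivative (\<lambda>v. v)) (at x)" by (auto intro!: derivative_eq_intros)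
  then have "(\<theta> has_derivative (\<lambda>v. v)) (at x)"
    by (rule has_derivative_transform_within_open[where s = "ball 0 r"]) (use \<theta> x in auto)
  then have D: "frechet_derivative \<theta> (at x) = (\<lambda>v. v)"
    using frechet_derivative_at by metis
  obtain B where "orthonormal_basis_of P B"
    using P orthonormal_basis_of_ex[of P] by (auto simp: grass_def)
  then have "orthonormal_basis_of P (SOME B. orthonormal_basis_of P B)" by (rule someI)
  note B = orthonormal_basis_ofD[OF this]
  show ?thesis
    using B P unfolding tangential_div_def D by (simp add: grass_def)
qed

section \<open>Coordinate functions as competitors for the eigenvalue\<close>

lemma gradient_eqI: "GDERIV u x :> D \<Longrightarrow> gradient u x = D"
  unfolding gradient_def
proof (rule the_equality)
  fix D' assume "GDERIV u x :> D" "GDERIV u x :> D'"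
  then have "(\<lambda>h. h \<bullet> D') = (\<lambda>h. h \<bullet> D)"
    unfolding gderiv_def by (rule has_derivative_unique[rotated])
  then show "D' = D" by (metis vector_eq_ldot)
qed

lemma tangential_gradient_coordinate:
  "tangential_gradient P (\<lambda>x. x $ i - a) x = orth_proj P (axis i 1)"
proof -
  have "GDERIV (\<lambda>x. x $ i - a) x :> axis i 1"
    unfolding gderiv_def
    by (auto intro!: derivative_eq_intros bounded_linear_imp_has_derivative bounded_linear_vec_nth
        simp: inner_axis)
  then show ?thesis by (simp add: tangential_gradient_def gradient_eqI)
qed

lemma smooth_coordinate: "smooth (\<lambda>x. x $ i - a)"
proof -
  have "Ck_function k (\<lambda>x. x $ i + - a)" for k
    by (intro Ck_function_add Ck_function_const Ck_function_bounded_linear bounded_linear_vec_nth)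
  then show ?thesis by (simp add: smooth_def)
qed


section \<open>Measurability of the tangential divergence\<close>

text \<open>The definition chooses a basis for each plane with no control on how it varies. Writing
  the divergence as the trace of the derivative composed with the projection removes that
  choice.\<close>

lemma tangential_div_eq_sum:
  fixes \<theta> :: "real^'n \<Rightarrow> real^'n"
  assumes P: "P \<in> grass m" and "linear (frechet_derivative \<theta> (at x))"
  shows "tangential_div P \<theta> x =
    (\<Sum>i\<in>UNIV. \<Sum>j\<in>UNIV. orth_proj P (axis i 1) $ j * frechet_derivative \<theta> (at x) (axis j 1) $ i)"
proof -
  interpret L: linear "frechet_derivative \<theta> (at x)" by fact
  let ?L = "frechet_derivative \<theta> (at x)"
  define B where "B = (SOME B. orthonormal_basis_of P B)"
  have "orthonormal_basis_of P B"
    unfolding B_def using P by (auto simp: grass_def intro: someI orthonormal_basis_of_ex)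
  note eq = orth_proj_eq_sum[OF this]
  have "(\<Sum>j\<in>UNIV. orth_proj P (axis i 1) $ j * ?L (axis j 1) $ i) = ?L (orth_proj P (axis i 1)) $ i" for i
  proof -
    have "?L (orth_proj P (axis i 1)) = ?L (\<Sum>j\<in>UNIV. orth_proj P (axis i 1) $ j *\<^sub>R axis j 1)"
      by (simp add: basis_expansion flip: scalar_mult_eq_scaleR)
    then show ?thesis by (simp add: L.sum L.scale)
  qed
  then have "(\<Sum>i\<in>UNIV. \<Sum>j\<in>UNIV. orth_proj P (axis i 1) $ j * ?L (axis j 1) $ i)
      = (\<Sum>i\<in>UNIV. \<Sum>b\<in>B. b $ i * ?L b $ i)"
    by (simp add: eq L.sum L.scale inner_axis')
  also have "\<dots> = (\<Sum>b\<in>B. ?L b \<bullet> b)"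
    by (subst sum.swap) (simp add: inner_vec_def mult.commute)
  finally show ?thesis by (simp add: tangential_div_def B_def)
qed

text \<open>In the coordinate formula the derivative entries are continuous in the base point and
  the projection entries are measurable. This allows the integrand of the first variation to be
  replaced almost everywhere.\<close>

lemma varifold_measurable_tangential_div:
  assumes V: "varifold m V" and "Ck_function 1 \<theta>"
  shows "(\<lambda>z. tangential_div (snd z) \<theta> (fst z)) \<in> borel_measurable V"
proof -
  have \<theta>: "Ck_function (Suc 0) \<theta>" using assms(2) by simp
  have "linear (frechet_derivative \<theta> (at x))" for x
    using Ck_function_Suc_derivative[OF \<theta>] by (rule has_derivative_linear)
  then have eq: "tangential_div (snd z) \<theta> (fst z) = (\<Sum>i\<in>UNIV. \<Sum>j\<in>UNIV.
      orth_proj (snd z) (axis i 1) $ j * frechet_derivative \<theta> (at (fst z)) (axis j 1) $ i)"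
    if "z \<in> space V" for z
    using that by (intro tangential_div_eq_sum[where m = m]) (auto simp: varifold_space[OF V])
  have "continuous_on UNIV (\<lambda>x. frechet_derivative \<theta> (at x) v)" for v using \<theta> by simp
  then have [measurable]: "(\<lambda>z. frechet_derivative \<theta> (at (fst z)) v) \<in> borel_measurable V" for v
    by (rule borel_measurable_continuous_on[OF _ varifold_measurable_fst[OF V]])
  note [measurable] = varifold_measurable_orth_proj_axis[OF V]
  show ?thesis
    by (subst measurable_cong[OF eq])
      (auto intro!: borel_measurable_sum borel_measurable_times
        borel_measurable_continuous_on[OF linear_continuous_on[OF bounded_linear_vec_nth]])
qed

section \<open>Cauchy-Schwarz for vector-valued functions\<close>

text \<open>The integral of the squared norm of \<open>t *\<^sub>R f x - g x\<close> is a quadratic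
  in \<open>t\<close> that is nowhere negative.\<close>

lemma integral_inner_Cauchy_Schwarz:
  fixes f g :: "'a \<Rightarrow> 'b::euclidean_space"
  assumes [measurable]: "f \<in> borel_measurable M" "g \<in> borel_measurable M"
    and f: "integrable M (\<lambda>x. (norm (f x))\<^sup>2)" and g: "integrable M (\<lambda>x. (norm (g x))\<^sup>2)"
  shows "(\<integral>x. f x \<bullet> g x \<partial>M)\<^sup>2 \<le> (\<integral>x. (norm (f x))\<^sup>2 \<partial>M) * (\<integral>x. (norm (g x))\<^sup>2 \<partial>M)"
proof -
  define A B D where "A = (\<integral>x. (norm (f x))\<^sup>2 \<partial>M)" and "B = (\<integral>x. (norm (g x))\<^sup>2 \<partial>M)"
    and "D = (\<integral>x. f x \<bullet> g x \<partial>M)"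
  have fg: "integrable M (\<lambda>x. f x \<bullet> g x)"
  proof (rule Bochner_Integration.integrable_bound[OF Bochner_Integration.integrable_add[OF f g]])
    have "\<bar>f x \<bullet> g x\<bar> \<le> (norm (f x))\<^sup>2 + (norm (g x))\<^sup>2" for x
      using Cauchy_Schwarz_ineq2[of "f x" "g x"] sum_squares_bound[of "norm (f x)" "norm (g x)"]
        mult_nonneg_nonneg[OF norm_ge_zero[of "f x"] norm_ge_zero[of "g x"]]
      by linarith
    then show "AE x in M. norm (f x \<bullet> g x) \<le> norm ((norm (f x))\<^sup>2 + (norm (g x))\<^sup>2)" by simp
  qed measurable
  have quad: "0 \<le> t\<^sup>2 * A - 2 * t * D + B" for t
  proof -
    have "0 \<le> (\<integral>x. (norm (t *\<^sub>R f x - g x))\<^sup>2 \<partial>M)" by simp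
    also have "\<dots> = (\<integral>x. t\<^sup>2 * (norm (f x))\<^sup>2 - 2 * t * (f x \<bullet> g x) + (norm (g x))\<^sup>2 \<partial>M)"
      unfolding power2_norm_eq_inner
      by (intro Bochner_Integration.integral_cong)
        (auto simp: inner_diff_left inner_diff_right inner_commute power2_eq_square algebra_simps)
    also have "\<dots> = t\<^sup>2 * A - 2 * t * D + B"
      using f g fg by (simp add: A_def B_def D_def)
    finally show ?thesis .
  qed
  have "A \<ge> 0" by (simp add: A_def)
  show ?thesis unfolding A_def[symmetric] B_def[symmetric] D_def[symmetric]
  proof (cases "A = 0")
    case True
    have "D = 0"
    proof (rule ccontr)
      assume "D \<noteq> 0"
      \<comment> \<open>For \<open>A = 0\<close> the quadratic is affine in \<open>t\<close>, and
        this \<open>t\<close> gives it the value -1.\<close>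
      then show False using quad[of "(B + 1) / (2 * D)"] True by simp
    qed
    with True show "D\<^sup>2 \<le> A * B" by simp
  next
    case False
    with \<open>A \<ge> 0\<close> have "A > 0" by simp
    \<comment> \<open>\<open>D / A\<close> minimises the quadratic.\<close>
    then show "D\<^sup>2 \<le> A * B" using quad[of "D / A"] by (simp add: field_simps power2_eq_square)
  qed
qed

section \<open>The eigenvalue bound from centred coordinates\<close>

theorem theorem1p1:
  fixes m :: nat
    and K :: "(real^'n) set"
    and g :: "real^'n \<Rightarrow> real"
    and V :: "((real^'n) \<times> (real^'n) set) measure"
    and H :: "real^'n \<Rightarrow> real^'n"
    and M :: real
  assumes "1 \<le> m" and "m \<le> CARD('n)"
    and "bounded K"
    and "rectifiable_varifold m V K g"
    and "in_class_H 2 V H"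
    and "emeasure V (UNIV \<times> grass m) = ennreal M" and "0 < M"
  shows "lambda1 V \<le> ereal ((Lp_norm 2 (weight V) H)\<^sup>2 / (real m * M))"
proof -
  let ?\<mu> = "weight V"
  have vf: "varifold m V" using assms(4) by (simp add: rectifiable_varifold_def)
  note space = varifold_space[OF vf]
  note [measurable] = varifold_measurable_fst[OF vf] varifold_measurable_orth_proj_axis[OF vf]
  have fin: "finite_measure V" by (rule finite_measureI) (simp add: space assms)
  interpret V: finite_measure V by (rule fin)
  interpret \<mu>: finite_measure ?\<mu>
    unfolding weight_def by (rule V.finite_measure_distr) measurable
  have sets_\<mu> [measurable_cong]: "sets ?\<mu> = sets borel" by (simp add: weight_def)
  have V_M: "measure V (space V) = M" using assms by (simp add: space measure_def)
  have \<mu>_M: "measure ?\<mu> (space ?\<mu>) = M"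
    using V_M by (simp add: weight_def measure_distr)
  obtain r where r: "K \<subseteq> cball 0 r" using assms(3) by (auto simp: bounded_iff subset_iff)
  have AE_V: "AE z in V. norm (fst z) \<le> r"
    by (rule rectifiable_varifold_AE_bounded[OF assms(4) r fin])
  then have AE_\<mu>: "AE x in ?\<mu>. norm x \<le> r"
    unfolding weight_def by (subst AE_distr_iff) auto

  \<comment> \<open>\<open>c\<close> is the centre of mass of the weight, which gives every centred
    coordinate mean zero. \<open>E i\<close> and \<open>J i\<close> are the numerator and
    denominator of its Rayleigh quotient.\<close>
  define c :: "real^'n" where "c = (\<chi> i. (\<integral>x. x $ i \<partial>?\<mu>) / M)"
  define J where "J i = (\<integral>x. (x $ i - c $ i)\<^sup>2 \<partial>?\<mu>)" for i
  define E where "E i = (\<integral>z. (norm (orth_proj (snd z) (axis i 1)))\<^sup>2 \<partial>V)" for i :: 'n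
  define A where "A = (\<integral>x. (norm (H x))\<^sup>2 \<partial>?\<mu>)"

  have coord: "integrable ?\<mu> (\<lambda>x. x $ i)" for i
  proof (rule \<mu>.integrable_const_bound)
    show "AE x in ?\<mu>. norm (x $ i) \<le> r"
      using AE_\<mu> by eventually_elim (use component_le_norm_cart in \<open>fastforce intro: order_trans\<close>)
  qed measurable
  have mean_0: "(\<integral>x. x $ i - c $ i \<partial>?\<mu>) = 0" for i
    using coord[of i] \<mu>_M assms(7) by (simp add: c_def)
  have dist_sq: "integrable ?\<mu> (\<lambda>x. (norm (x - c))\<^sup>2)"
  proof (rule \<mu>.integrable_const_bound)
    show "AE x in ?\<mu>. norm ((norm (x - c))\<^sup>2) \<le> (r + norm c)\<^sup>2"
      using AE_\<mu>
    proof eventually_elim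
      case (elim x)
      then have "norm (x - c) \<le> r + norm c" using norm_triangle_ineq4[of x c] by linarith
      then show ?case by (simp add: power_mono)
    qed
  qed measurable
  have coord_sq: "integrable ?\<mu> (\<lambda>x. (x $ i - c $ i)\<^sup>2)" for i
  proof (rule Bochner_Integration.integrable_bound[OF dist_sq])
    have "\<bar>x $ i - c $ i\<bar> \<le> norm (x - c)" for x
      using component_le_norm_cart[of "x - c" i] by simp
    then show "AE x in ?\<mu>. norm ((x $ i - c $ i)\<^sup>2) \<le> norm ((norm (x - c))\<^sup>2)"
      by (simp add: abs_le_square_iff[symmetric] abs_square_le_1)
  qed measurable
  have "(norm (x - c))\<^sup>2 = (\<Sum>i\<in>UNIV. (x $ i - c $ i)\<^sup>2)" for x
    unfolding power2_norm_eq_inner by (simp add: inner_vec_def power2_eq_square)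
  then have sum_J: "(\<integral>x. (norm (x - c))\<^sup>2 \<partial>?\<mu>) = (\<Sum>i\<in>UNIV. J i)"
    unfolding J_def using coord_sq by (simp add: Bochner_Integration.integral_sum)

  \<comment> \<open>One term of the trace is at most the whole trace; over a finite measure this
    crude bound suffices for integrability.\<close>
  have proj_le: "(norm (orth_proj P (axis i 1)))\<^sup>2 \<le> real m" if "P \<in> grass m" for P and i :: 'n
    using that sum_norm_orth_proj_axis[of P]
      member_le_sum[of i UNIV "\<lambda>i. (norm (orth_proj P (axis i 1)))\<^sup>2"]
    by (auto simp: grass_def)
  have "integrable V (\<lambda>z. (norm (orth_proj (snd z) (axis i 1)))\<^sup>2)" for i
    by (rule V.integrable_const_bound[where B = "real m"]) (auto simp: space proj_le)
  then have "(\<Sum>i\<in>UNIV. E i) = (\<integral>z. (\<Sum>i\<in>UNIV. (norm (orth_proj (snd z) (axis i 1)))\<^sup>2) \<partial>V)"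
    unfolding E_def by (subst Bochner_Integration.integral_sum) auto
  also have "\<dots> = (\<integral>z. real m \<partial>V)"
    by (intro Bochner_Integration.integral_cong) (auto simp: space grass_def sum_norm_orth_proj_axis)
  finally have sum_E: "(\<Sum>i\<in>UNIV. E i) = real m * M" by (simp add: V_M)

  \<comment> \<open>The radius \<open>r + 1\<close> leaves a margin: computing the derivative at
    points with norm up to \<open>r\<close> needs a neighbourhood where \<theta> is a
    translation.\<close>
  obtain \<theta> where \<theta>: "test_field \<theta>" "\<And>x. norm x \<le> r + 1 \<Longrightarrow> \<theta> x = x - c"
    using ex_test_field_eq_translation_on_ball by blast
  have Ck: "Ck_function k \<theta>" for k using \<theta>(1) by (simp add: test_field_def smooth_def)
  have [measurable]: "\<theta> \<in> borel_measurable borel"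
    using Ck[of 0] by (simp add: borel_measurable_continuous_onI)
  have H_meas: "H \<in> borel_measurable ?\<mu>" and H_sq: "integrable ?\<mu> (\<lambda>x. (norm (H x))\<^sup>2)"
    and H_var: "first_variation V \<theta> = - (\<integral>x. H x \<bullet> \<theta> x \<partial>?\<mu>)"
    using assms(5) \<theta>(1) by (auto simp: in_class_H_def in_Lp_def generalized_mean_curvature_def)
  note [measurable] = H_meas
  \<comment> \<open>Almost every base point has norm at most \<open>r\<close>, where the cut-off is
    invisible, so both sides of the first variation formula can be computed as if the field were
    \<open>x - c\<close>.\<close>
  have "first_variation V \<theta> = (\<integral>z. real m \<partial>V)"
    unfolding first_variation_def
  proof (rule Bochner_Integration.integral_cong_AE)
    show "(\<lambda>z. tangential_div (snd z) \<theta> (fst z)) \<in> borel_measurable V"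
      by (rule varifold_measurable_tangential_div[OF vf Ck])
    show "AE z in V. tangential_div (snd z) \<theta> (fst z) = real m"
      using AE_V AE_space
      by eventually_elim
        (auto simp: space intro!: tangential_div_translation_on_ball[where r = "r + 1"] \<theta>(2))
  qed simp
  moreover have "(\<integral>x. H x \<bullet> \<theta> x \<partial>?\<mu>) = (\<integral>x. H x \<bullet> (x - c) \<partial>?\<mu>)"
    by (rule Bochner_Integration.integral_cong_AE) (measurable, use AE_\<mu> \<theta>(2) in \<open>auto elim!: eventually_mono\<close>)
  ultimately have "real m * M = - (\<integral>x. H x \<bullet> (x - c) \<partial>?\<mu>)"
    using H_var by (simp add: V_M)
  then have key: "(real m * M)\<^sup>2 \<le> A * (\<Sum>i\<in>UNIV. J i)"
    using integral_inner_Cauchy_Schwarz[OF H_meas _ H_sq dist_sq] by (simp add: A_def sum_J)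

  have mM: "real m * M > 0" using assms by simp
  \<comment> \<open>Averaging: if no coordinate worked, summing the reversed inequalities would
    contradict \<open>key\<close>. A coordinate with \<open>J i = 0\<close> gives no admissible
    competitor and only a weak inequality, from \<open>E i \<ge> 0\<close>. Strictness of the sum
    comes from some \<open>J i \<noteq> 0\<close>, which exists because \<open>key\<close> bounds a
    positive number by a multiple of the sum of the \<open>J i\<close>.\<close>
  obtain i where i: "J i \<noteq> 0" "E i \<le> A / (real m * M) * J i"
  proof (rule ccontr)
    assume "\<not> thesis"
    with that have less: "A / (real m * M) * J i < E i" if "J i \<noteq> 0" for i
      using \<open>J i \<noteq> 0\<close> by force
    have "A / (real m * M) * J i \<le> E i" for i
      using less[of i] by (cases "J i = 0") (auto simp: E_def)
    moreover have "\<exists>i. J i \<noteq> 0"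
    proof (rule ccontr)
      assume "\<nexists>i. J i \<noteq> 0"
      then show False using key mM by auto
    qed
    ultimately have "(\<Sum>i\<in>UNIV. A / (real m * M) * J i) < (\<Sum>i\<in>UNIV. E i)"
      using less by (intro sum_strict_mono_ex1) auto
    then have "A / (real m * M) * (\<Sum>i\<in>UNIV. J i) < real m * M"
      by (simp add: sum_E sum_distrib_left)
    then have "A * (\<Sum>i\<in>UNIV. J i) < (real m * M)\<^sup>2"
      using mM by (simp add: pos_divide_less_eq power2_eq_square)
    with key show False by simp
  qed
  have "lambda1 V \<le> ereal (E i / J i)"
    unfolding lambda1_def
    by (rule Inf_lower, rule CollectI, rule exI[of _ "\<lambda>x. x $ i - c $ i"])
      (use i(1) in \<open>simp add: smooth_coordinate mean_0 tangential_gradient_coordinate E_def J_def\<close>)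
  also have "E i / J i \<le> A / (real m * M)"
  proof -
    have "J i \<ge> 0" by (simp add: J_def)
    with i show ?thesis by (simp add: pos_divide_le_eq)
  qed
  also have "A = (Lp_norm 2 ?\<mu> H)\<^sup>2"
    by (simp add: Lp_norm_def powr_half_sqrt A_def)
  finally show ?thesis by simp
qed

end
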